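(* Let $R$ be a Noetherian commutative ring with identity and let $P$ be a finite subset of elements of $R$. Let $P_0,\dots,P_r$ be subsets of $P$ such that (i) $\bigcup_{l=0}^r P_l=P$; (ii) $P_0$ has exactly one element; (iii) if $p$ and $p'$ are different elements of $P_l$ $(0<l\leq r)$, then $(pp')^m\in\left(\bigcup_{i=0}^{l-1}P_i\right)$ for some positive integer $m$. Set $q_l=\sum_{p\in P_l}p^{e(p)}$ for $l=0,\dots,r$, where the $e(p)\geq 1$ are arbitrary integers. Then $$\sqrt{(P)}=\sqrt{(q_0,\dots,q_r)}.$$
   Context: For a subset $S$ of $R$, $(S)$ denotes the ideal of $R$ generated by the elements of $S$, and $\sqrt{\,\cdot\,}$ denotes the radical of an ideal. *)

theory Defs
  imports "HOL-Algebra.Algebra"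
begin

definition radical :: "('a, 'b) ring_scheme \<Rightarrow> 'a set \<Rightarrow> 'a set" where
  "radical R I = {x \<in> carrier R. \<exists>n::nat. n \<ge> 1 \<and> x [^]\<^bsub>R\<^esub> n \<in> I}"

end

theory Submission
  imports Defs
begin

text \<open>
  Let \<open>J\<close> be the ideal generated by the \<open>q\<^sub>l\<close>. By strong induction on \<open>l\<close>, each \<open>P\<^sub>l\<close> lies in the
  radical of \<open>J\<close>: for distinct \<open>p, p'\<close> in \<open>P\<^sub>l\<close> the product \<open>p p'\<close> is in the radical by the induction
  hypothesis (for \<open>l = 0\<close> there are none), so multiplying \<open>q\<^sub>l\<close> by \<open>p\<close> kills every summand
  modulo the radical except \<open>p\<^bsup>e(p)+1\<^esup>\<close>, whence \<open>p\<close> itself lies in the radical.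
\<close>

context cring
begin

text \<open>The factor \<open>z\<close> lets an induction on \<open>a + b\<close> replace the binomial theorem.\<close>

lemma ideal_mult_add_pow_closed:
  fixes a b :: nat
  assumes "ideal I R" "x \<in> carrier R" "y \<in> carrier R" "z \<in> carrier R"
    and "z \<otimes> x [^] a \<in> I" "z \<otimes> y [^] b \<in> I"
  shows "z \<otimes> (x \<oplus> y) [^] (a + b) \<in> I"
  using assms(4-)
proof (induction "a + b" arbitrary: a b z)
  case 0
  then show ?case by simp
next
  case (Suc n)
  interpret I: ideal I R by fact
  note [simp] = assms(2,3) Suc.prems(1)
  show ?case
  proof (cases "a = 0 \<or> b = 0")
    case True
    \<comment> \<open>A zeroth power is \<open>\<one>\<close>, so one of the two hypotheses already
      puts \<open>z\<close> in \<open>I\<close>.\<close>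
    then have "z \<in> I" using Suc.prems by auto
    then show ?thesis by (simp add: I.I_r_closed)
  next
    case False
    then obtain a' b' where ab: "a = Suc a'" "b = Suc b'" by (metis not0_implies_Suc)
    \<comment> \<open>One factor \<open>x \<oplus> y\<close> is split off and absorbed into the
      multiplier: \<open>z \<otimes> x\<close> needs one power of \<open>x\<close> less,
      \<open>z \<otimes> y\<close> one power of \<open>y\<close> less. Both instances then have
      exponent sum \<open>n\<close>.\<close>
    have "z \<otimes> x \<otimes> x [^] a' \<in> I" "z \<otimes> y \<otimes> y [^] b' \<in> I"
      using Suc.prems ab by (simp_all add: m_ac)
    moreover have "z \<otimes> x \<otimes> y [^] b \<in> I" "z \<otimes> y \<otimes> x [^] a \<in> I"
      using I.I_l_closed[OF Suc.prems(3), of x] I.I_l_closed[OF Suc.prems(2), of y]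
      by (simp_all add: m_ac)
    ultimately have "z \<otimes> x \<otimes> (x \<oplus> y) [^] (a' + b) \<in> I" "z \<otimes> y \<otimes> (x \<oplus> y) [^] (a + b') \<in> I"
      using Suc.hyps(1)[of a' b "z \<otimes> x"] Suc.hyps(1)[of a b' "z \<otimes> y"] Suc.hyps(2)
        Suc.prems ab by auto
    moreover have "a' + b = n" "a + b' = n" using Suc.hyps(2) ab by auto
    ultimately have "z \<otimes> x \<otimes> (x \<oplus> y) [^] n \<oplus> z \<otimes> y \<otimes> (x \<oplus> y) [^] n \<in> I"
      by (simp add: I.a_closed)
    moreover have "z \<otimes> (x \<oplus> y) [^] Suc n = z \<otimes> x \<otimes> (x \<oplus> y) [^] n \<oplus> z \<otimes> y \<otimes> (x \<oplus> y) [^] n"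
    proof -
      define w where "w = (x \<oplus> y) [^] n"
      have [simp]: "w \<in> carrier R" by (simp add: w_def)
      have "z \<otimes> (w \<otimes> (x \<oplus> y)) = z \<otimes> x \<otimes> w \<oplus> z \<otimes> y \<otimes> w"
        by (simp add: r_distr l_distr m_ac)
      then show ?thesis by (simp add: w_def)
    qed
    ultimately show ?thesis using Suc.hyps(2) by simp
  qed
qed

lemma pow_in_ideal:
  assumes "ideal I R" "x \<in> I" "(n::nat) \<ge> 1"
  shows "x [^] n \<in> I"
proof -
  interpret I: ideal I R by fact
  obtain k where "n = Suc k" using assms(3) by (cases n) auto
  then show ?thesis using assms(2) by (simp add: I.I_l_closed I.Icarr)
qed

lemma subset_radical:
  assumes "ideal I R"
  shows "I \<subseteq> radical R I"
proof
  fix x assume "x \<in> I"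
  then have "x \<in> carrier R" "x [^] (1::nat) \<in> I"
    using ideal.Icarr[OF assms] by auto
  then show "x \<in> radical R I" unfolding radical_def by blast
qed

text \<open>Sums come from \<open>ideal_mult_add_pow_closed\<close> with multiplier
  \<open>\<one>\<close>, multiples from (xy)^n = x^n y^n, and negatives are multiples by -1.\<close>

lemma radical_ideal:
  assumes "ideal I R"
  shows "ideal (radical R I) R"
proof -
  interpret I: ideal I R by fact
  have mult: "x \<otimes> y \<in> radical R I" if "x \<in> carrier R" "y \<in> radical R I" for x y
    using that by (auto simp: radical_def nat_pow_distrib intro: I.I_l_closed)
  show ?thesis
  proof (rule idealI)
    show "ring R" by (rule ring_axioms)
    show "subgroup (radical R I) (add_monoid R)"
    proof (rule add.subgroupI)
      show "radical R I \<subseteq> carrier R" by (auto simp: radical_def)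
      show "radical R I \<noteq> {}" using subsetD[OF subset_radical[OF assms] I.zero_closed] by force
      fix x assume x: "x \<in> radical R I"
      then have xc: "x \<in> carrier R" by (simp add: radical_def)
      show "\<ominus> x \<in> radical R I"
        using mult[of "\<ominus> \<one>" x] x xc by (simp add: l_minus)
      fix y assume y: "y \<in> radical R I"
      then have yc: "y \<in> carrier R" by (simp add: radical_def)
      obtain a b :: nat where "a \<ge> 1" "x [^] a \<in> I" "y [^] b \<in> I"
        using x y by (auto simp: radical_def)
      moreover from this have "\<one> \<otimes> (x \<oplus> y) [^] (a + b) \<in> I"
        by (intro ideal_mult_add_pow_closed[OF assms xc yc]) (use xc yc in auto)
      ultimately have "a + b \<ge> 1" "(x \<oplus> y) [^] (a + b) \<in> I"
        using xc yc by auto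
      then show "x \<oplus> y \<in> radical R I"
        unfolding radical_def using xc yc by blast
    qed
    fix a x assume "a \<in> radical R I" "x \<in> carrier R"
    then show "x \<otimes> a \<in> radical R I" "a \<otimes> x \<in> radical R I"
      using mult[of x a] m_comm[of x a] by (simp_all add: radical_def)
  qed
qed

lemma radical_mono: "I \<subseteq> J \<Longrightarrow> radical R I \<subseteq> radical R J"
  by (auto simp: radical_def)

text \<open>Exponents multiply under iterated powers. This is idempotence of the radical, element by
  element.\<close>

lemma pow_in_radicalD:
  assumes "x \<in> carrier R" "(n::nat) \<ge> 1" "x [^] n \<in> radical R I"
  shows "x \<in> radical R I"
proof -
  obtain k :: nat where "k \<ge> 1" "(x [^] n) [^] k \<in> I"
    using assms(3) by (auto simp: radical_def)
  then have "n * k \<ge> 1" "x [^] (n * k) \<in> I"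
    using assms(1,2) by (auto simp: nat_pow_pow)
  then show ?thesis unfolding radical_def using assms(1) by blast
qed

lemma finsum_in_ideal:
  assumes "ideal I R" "\<And>a. a \<in> A \<Longrightarrow> f a \<in> I"
  shows "(\<Oplus>a\<in>A. f a) \<in> I"
proof -
  interpret I: ideal I R by fact
  show ?thesis
    using assms(2)
  \<comment> \<open>Finiteness of \<open>A\<close> is not assumed: over an infinite set the sum is
    \<open>\<zero>\<close> by convention.\<close>
  proof (induction A rule: infinite_finite_induct)
    case (insert x F)
    then have "f \<in> F \<rightarrow> carrier R" "f x \<in> carrier R" using I.Icarr by auto
    with insert show ?case by (simp add: I.a_closed)
  qed (simp_all add: I.zero_closed)
qed

text \<open>The inductive step for one fixed \<open>p\<close>. The products with \<open>p\<close>
  are asked to lie only in the radical, since that is what the induction supplies.\<close>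

lemma summand_base_in_radical:
  assumes I: "ideal I R" and A: "finite A" "A \<subseteq> carrier R"
    and e: "\<And>a. a \<in> A \<Longrightarrow> (e a :: nat) \<ge> 1"
    and sum: "(\<Oplus>a\<in>A. a [^] e a) \<in> radical R I"
    and prod: "\<And>b. b \<in> A \<Longrightarrow> p \<noteq> b \<Longrightarrow> p \<otimes> b \<in> radical R I"
    and p: "p \<in> A"
  shows "p \<in> radical R I"
proof -
  interpret Q: ideal "radical R I" R by (rule radical_ideal[OF I])
  have pc: "p \<in> carrier R" using A p by auto
  define s where "s = (\<Oplus>a\<in>A - {p}. a [^] e a)"
  have fc: "(\<lambda>a. a [^] e a) \<in> A - {p} \<rightarrow> carrier R" using A by auto
  then have sc: "s \<in> carrier R" unfolding s_def by (rule finsum_closed)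
  have "(\<Oplus>a\<in>A. a [^] e a) = (\<Oplus>a\<in>insert p (A - {p}). a [^] e a)"
    using p by (simp add: insert_absorb)
  also have "\<dots> = p [^] e p \<oplus> s"
    unfolding s_def by (rule finsum_insert) (use A fc pc in auto)
  finally have "p \<otimes> (p [^] e p \<oplus> s) \<in> radical R I"
    using sum pc by (simp add: Q.I_l_closed)
  then have total: "p [^] Suc (e p) \<oplus> p \<otimes> s \<in> radical R I"
    using pc sc by (simp add: r_distr m_comm)
  \<comment> \<open>As \<open>e a\<close> is positive, one factor \<open>a\<close> can be paired
    with \<open>p\<close>, which makes the term a multiple of \<open>p \<otimes> a\<close>.\<close>
  have "p \<otimes> a [^] e a \<in> radical R I" if a: "a \<in> A - {p}" for a
  proof -
    obtain k where "e a = Suc k" using e[of a] a by (cases "e a") auto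
    moreover have "a \<in> carrier R" using a A by auto
    moreover have "p \<otimes> a \<in> radical R I" using prod[of a] a by auto
    ultimately show ?thesis
      using pc Q.I_r_closed[of "p \<otimes> a" "a [^] k"] by (simp add: m_ac)
  qed
  then have "p \<otimes> s \<in> radical R I"
    unfolding s_def finsum_rdistr[OF finite_Diff[OF A(1)] pc fc]
    by (rule finsum_in_ideal[OF Q.ideal_axioms])
  with total have "(p [^] Suc (e p) \<oplus> p \<otimes> s) \<ominus> p \<otimes> s \<in> radical R I"
    by (simp add: a_minus_def Q.a_closed Q.a_inv_closed)
  then have "p [^] Suc (e p) \<in> radical R I"
    using pc sc by (simp add: a_minus_def a_assoc r_neg)
  then show ?thesis by (rule pow_in_radicalD[OF pc, rotated]) simp
qed

end

theorem lemma2: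
  fixes R :: "('a, 'b) ring_scheme" (structure)
    and P :: "'a set"
    and Ps :: "nat \<Rightarrow> 'a set"
    and r :: nat
    and e :: "'a \<Rightarrow> nat"
    and q :: "nat \<Rightarrow> 'a"
  assumes "cring R" and "noetherian_ring R"
    and "finite P" and "P \<subseteq> carrier R"
    and subsets: "\<And>l. l \<le> r \<Longrightarrow> Ps l \<subseteq> P"
    and i: "(\<Union>l\<in>{0..r}. Ps l) = P"
    and ii: "card (Ps 0) = 1"
    and iii: "\<And>l p p'. \<lbrakk>0 < l; l \<le> r; p \<in> Ps l; p' \<in> Ps l; p \<noteq> p'\<rbrakk>
               \<Longrightarrow> \<exists>m::nat. m > 0 \<and> (p \<otimes> p') [^] m \<in> Idl (\<Union>i\<in>{0..<l}. Ps i)"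
    and e: "\<And>p. p \<in> P \<Longrightarrow> e p \<ge> 1"
    and q: "\<And>l. l \<le> r \<Longrightarrow> q l = (\<Oplus>p\<in>Ps l. p [^] e p)"
  shows "radical R (Idl P) = radical R (Idl (q ` {0..r}))"
proof
  interpret cring R by fact
  note IP = genideal_ideal[OF \<open>P \<subseteq> carrier R\<close>] and PI = genideal_self[OF \<open>P \<subseteq> carrier R\<close>]
  have qP: "q ` {0..r} \<subseteq> Idl P"
  proof clarify
    fix l assume "l \<in> {0..r}"
    then have l: "l \<le> r" by simp
    show "q l \<in> Idl P"
      unfolding q[OF l]
      by (rule finsum_in_ideal[OF IP], rule pow_in_ideal[OF IP]) (use subsets[OF l] PI e in auto)
  qed
  then show "radical R (Idl (q ` {0..r})) \<subseteq> radical R (Idl P)"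
    by (intro radical_mono genideal_minimal[OF IP])
  define J where "J = Idl (q ` {0..r})"
  have qc: "q ` {0..r} \<subseteq> carrier R" using qP ideal.Icarr[OF IP] by blast
  have J: "ideal J R" unfolding J_def by (rule genideal_ideal[OF qc])
  have rJ: "ideal (radical R J) R" by (rule radical_ideal[OF J])
  have "Ps l \<subseteq> radical R J" if "l \<le> r" for l
    using that
  proof (induction l rule: less_induct)
    case (less l)
    have "Ps l \<subseteq> carrier R" "finite (Ps l)"
      using subsets[OF less.prems] \<open>P \<subseteq> carrier R\<close> \<open>finite P\<close> by (auto intro: finite_subset)
    show ?case
    proof
      fix p assume p: "p \<in> Ps l"
      show "p \<in> radical R J"
      proof (rule summand_base_in_radical[where e = e,
            OF J \<open>finite (Ps l)\<close> \<open>Ps l \<subseteq> carrier R\<close> _ _ _ p])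
        show "e a \<ge> 1" if "a \<in> Ps l" for a using e subsets[OF less.prems] that by blast
        have "q l \<in> J" unfolding J_def using genideal_self[OF qc] less.prems by auto
        then show "(\<Oplus>a\<in>Ps l. a [^] e a) \<in> radical R J"
          using subset_radical[OF J] q[OF less.prems] by auto
        fix b assume b: "b \<in> Ps l" "p \<noteq> b"
        \<comment> \<open>\<open>Ps 0\<close> is a singleton and cannot contain the distinct
          elements \<open>p\<close> and \<open>b\<close>, so \<open>iii\<close> applies.\<close>
        have "l > 0"
          using ii p b by (auto simp: card_1_singleton_iff intro!: gr0I)
        then obtain m :: nat where m: "m > 0" "(p \<otimes> b) [^] m \<in> Idl (\<Union>i\<in>{0..<l}. Ps i)"
          using iii less.prems p b by blast
        \<comment> \<open>The radical is an ideal and contains every earlier \<open>Ps i\<close> by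
          induction, hence also the ideal they generate together.\<close>
        have "Idl (\<Union>i\<in>{0..<l}. Ps i) \<subseteq> radical R J"
          using less by (intro genideal_minimal[OF rJ] UN_least) simp
        moreover have "p \<otimes> b \<in> carrier R"
          using p b by (intro m_closed subsetD[OF \<open>Ps l \<subseteq> carrier R\<close>])
        ultimately show "p \<otimes> b \<in> radical R J"
          using m by - (rule pow_in_radicalD[where n = m], auto)
      qed
    qed
  qed
  then have "P \<subseteq> radical R J"
    unfolding i[symmetric] by (intro UN_least) simp
  then have IPJ: "Idl P \<subseteq> radical R J" by (rule genideal_minimal[OF rJ])
  show "radical R (Idl P) \<subseteq> radical R (Idl (q ` {0..r}))"
    unfolding J_def[symmetric]
  proof
    fix x assume "x \<in> radical R (Idl P)"
    then obtain n :: nat where "x \<in> carrier R" "n \<ge> 1" "x [^] n \<in> Idl P"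
      unfolding radical_def by blast
    \<comment> \<open>A power of \<open>x\<close> lies in \<open>Idl P\<close>, hence in the radical
      of \<open>J\<close>; idempotence brings \<open>x\<close> itself there.\<close>
    then show "x \<in> radical R J" using pow_in_radicalD IPJ by (meson subsetD)
  qed
qed

end
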